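(* Let $N\geq1$, $g>0$, $\gamma_1,\dots,\gamma_N>0$ with $\sum_{i=1}^N\gamma_i=1$, $\boldsymbol{H}_N=(H_1,\dots,H_N)^T\in\mathbb{R}^N$ with $H_i>0$ for all $i$, and $\tilde{\boldsymbol{U}}_N=(\tilde u_1,\dots,\tilde u_N)^T\in\mathbb{R}^N$. Let $A_N$ be the $2N\times2N$ block matrix $$A_N=\begin{pmatrix}\mathrm{diag}(\tilde{\boldsymbol{U}}_N)&\mathrm{diag}(\boldsymbol{H}_N)\\ g\,\mathbf{1}_N\otimes\boldsymbol{\gamma}_N&\mathrm{diag}(\tilde{\boldsymbol{U}}_N)\end{pmatrix}.$$ Set $\tilde u_-=\inf_\alpha\tilde u_\alpha$, $\tilde u_+=\sup_\alpha\tilde u_\alpha$ and $h_N=\sum_{i=1}^N\gamma_iH_i$. Then the set $\sigma(A_N)$ of eigenvalues of $A_N$ is contained in the union of the following $N+2$ sets: $$J_-=\bigl[\tilde u_--\sqrt{gh_N},\tilde u_-\bigr),\qquad J_+=\bigl(\tilde u_+,\tilde u_++\sqrt{gh_N}\bigr],$$ $$D_i=\left\{z\in\mathbb{C}:|z-\tilde u_i|\leq\sqrt{gh_N}\text{ and }\tilde u_-\leq\mathrm{Re}\,z\leq\tilde u_+\right\},\qquad1\leq i\leq N.$$ Moreover, there exist exactly two eigenvalues $c_\pm$ in the intervals $J_\pm$: $$\sigma(A_N)\cap J_\pm=\{c_\pm\}.$$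
   Context: $\mathbf{1}_N=(1,\dots,1)^T\in\mathbb{R}^N$, $\boldsymbol{\gamma}_N=(\gamma_1,\dots,\gamma_N)^T$, and $\mathbf{1}_N\otimes\boldsymbol{\gamma}_N$ is the $N\times N$ matrix with entries $(\mathbf{1}_N\otimes\boldsymbol{\gamma}_N)_{ij}=\gamma_j$. The last assertion means: $J_-$ contains exactly one eigenvalue, $c_-$, and $J_+$ contains exactly one eigenvalue, $c_+$. *)

theory Defs
  imports Complex_Main "Jordan_Normal_Form.Spectral_Radius"
begin

text \<open>
  Vectors are \<open>real vec\<close> of dimension \<open>N\<close>, so components are indexed by \<open>0, \<dots>, N - 1\<close>.
\<close>

definition diag_of_vec :: "'a :: zero vec \<Rightarrow> 'a mat" where
  "diag_of_vec v = mat_diag (dim_vec v) (\<lambda>i. v $ i)"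

definition outer_prod :: "'a :: times vec \<Rightarrow> 'a vec \<Rightarrow> 'a mat" where
  "outer_prod v w = mat (dim_vec v) (dim_vec w) (\<lambda>(i, j). v $ i * w $ j)"

definition ones_vec :: "nat \<Rightarrow> 'a :: one vec" where
  "ones_vec N = vec N (\<lambda>_. 1)"

definition A_mat :: "nat \<Rightarrow> real \<Rightarrow> real vec \<Rightarrow> real vec \<Rightarrow> real vec \<Rightarrow> real mat" where
  "A_mat N g \<gamma> H U =
     four_block_mat
       (diag_of_vec U)                               (diag_of_vec H)
       (g \<cdot>\<^sub>m outer_prod (ones_vec N) \<gamma>)  (diag_of_vec U)"

text \<open>The real matrix is viewed over \<open>\<complex>\<close>, so that non-real eigenvalues are included.\<close>

definition complex_spectrum :: "real mat \<Rightarrow> complex set" where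
  "complex_spectrum A = spectrum (map_mat complex_of_real A)"

definition u_minus :: "real vec \<Rightarrow> real" where
  "u_minus U = (INF i\<in>{..<dim_vec U}. U $ i)"

definition u_plus :: "real vec \<Rightarrow> real" where
  "u_plus U = (SUP i\<in>{..<dim_vec U}. U $ i)"

definition mean_height :: "nat \<Rightarrow> real vec \<Rightarrow> real vec \<Rightarrow> real" where
  "mean_height N \<gamma> H = (\<Sum>i<N. \<gamma> $ i * H $ i)"

definition J_minus :: "real \<Rightarrow> real \<Rightarrow> real vec \<Rightarrow> complex set" where
  "J_minus g h U = complex_of_real ` {u_minus U - sqrt (g * h) ..< u_minus U}"

definition J_plus :: "real \<Rightarrow> real \<Rightarrow> real vec \<Rightarrow> complex set" where
  "J_plus g h U = complex_of_real ` {u_plus U <.. u_plus U + sqrt (g * h)}"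

definition D_set :: "real \<Rightarrow> real \<Rightarrow> real vec \<Rightarrow> nat \<Rightarrow> complex set" where
  "D_set g h U i =
     {z. cmod (z - complex_of_real (U $ i)) \<le> sqrt (g * h) \<and> u_minus U \<le> Re z \<and> Re z \<le> u_plus U}"

end

(*
  Off the points u_i, eliminating the eigenvector shows that z is an eigenvalue if and only if the
  secular equation g * (SUM i. gamma_i H_i / (z - u_i)^2) = 1 holds. If every |z - u_i| exceeds
  sqrt (g h), the left-hand side has modulus below 1. If Re z lies outside [u_-, u_+] and z is not
  real, all summands have imaginary parts of the same nonzero sign. On the half-line right of u_+
  the left-hand side strictly decreases from infinity and is at most 1 at u_+ + sqrt (g h), which
  gives exactly one root there; the half-line left of u_- is its mirror image.
*)
theory Submission
  imports Defs
begin

section \<open>Roots of the secular equation with positive weights\<close>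

lemma Im_inverse_power2_pos:
  assumes "Re z * Im z < 0"
  shows "Im (1 / z\<^sup>2) > 0"
proof -
  have "z \<noteq> 0" using assms by auto
  then have "z\<^sup>2 \<noteq> 0" by simp
  then have "(Re (z\<^sup>2))\<^sup>2 + (Im (z\<^sup>2))\<^sup>2 > 0"
    by (simp add: complex_eq_iff sum_power2_gt_zero_iff)
  \<comment> \<open>Here Im (z^2) = 2 Re z Im z, and inverting z^2 flips the sign of its imaginary
    part.\<close>
  moreover have "Im (z\<^sup>2) < 0"
    using assms by (simp add: power2_eq_square mult.commute)
  ultimately show ?thesis
    by (simp add: Im_divide divide_neg_pos)
qed

text \<open>For non-real z on one side of all poles, the differences z - u_i share one open
  quadrant. Squaring and inverting sends that quadrant into a single open half-plane bounded by the
  real axis. A positive combination of such values stays in that half-plane, so it cannot equal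
  1.\<close>

lemma secular_root_real:
  fixes w u :: "'i \<Rightarrow> real" and z :: complex
  assumes "finite I" and "I \<noteq> {}" and w: "\<And>i. i \<in> I \<Longrightarrow> w i > 0"
    and outside: "(\<forall>i\<in>I. Re z < u i) \<or> (\<forall>i\<in>I. u i < Re z)"
    and root: "(\<Sum>i\<in>I. of_real (w i) / (z - of_real (u i))\<^sup>2) = 1"
  shows "Im z = 0"
proof (rule ccontr)
  assume Im: "Im z \<noteq> 0"
  define s where "s i = Im (1 / (z - of_real (u i))\<^sup>2)" for i
  have sum0: "(\<Sum>i\<in>I. w i * s i) = 0"
  proof -
    have "(\<Sum>i\<in>I. w i * s i) = Im (\<Sum>i\<in>I. of_real (w i) / (z - of_real (u i))\<^sup>2)"
      unfolding s_def Im_sum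
      by (intro sum.cong refl) (simp add: divide_inverse)
    then show ?thesis using root by simp
  qed
  have sgn: "s i > 0" if "(Re z - u i) * Im z < 0" for i
    using Im_inverse_power2_pos[of "z - of_real (u i)"] that by (simp add: s_def)
  have sgn': "s i < 0" if "(Re z - u i) * Im z > 0" for i
  proof -
    \<comment> \<open>Conjugation reverses the sign of Re * Im and of the imaginary part of the
      inverse square, so the remaining quadrants reduce to
      \<open>Im_inverse_power2_pos\<close>.\<close>
    have "1 / (cnj (z - of_real (u i)))\<^sup>2 = cnj (1 / (z - of_real (u i))\<^sup>2)"
      by simp
    then have "Im (1 / (cnj (z - of_real (u i)))\<^sup>2) = - s i"
      by (simp only: s_def cnj.sel)
    then show ?thesis
      using Im_inverse_power2_pos[of "cnj (z - of_real (u i))"] that by simp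
  qed
  have "(\<forall>i\<in>I. (Re z - u i) * Im z < 0) \<or> (\<forall>i\<in>I. (Re z - u i) * Im z > 0)"
    using outside Im by (auto simp: mult_less_0_iff zero_less_mult_iff)
  then show False
  proof
    assume "\<forall>i\<in>I. (Re z - u i) * Im z < 0"
    then have "(\<Sum>i\<in>I. w i * s i) > 0"
      using assms(1,2) w sgn by (intro sum_pos) auto
    then show False using sum0 by simp
  next
    assume "\<forall>i\<in>I. (Re z - u i) * Im z > 0"
    then have "(\<Sum>i\<in>I. w i * - s i) > 0"
      using assms(1,2) w sgn' by (intro sum_pos) (auto simp: mult_pos_neg)
    then show False using sum0 by (simp add: sum_negf)
  qed
qed

text \<open>The radius is chosen so that a summand at exactly this distance from its pole has
  modulus \<open>w i / sum w I\<close>, and these shares add up to 1. If all poles were farther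
  away, the triangle inequality would give 1 < 1.\<close>

lemma secular_root_close:
  fixes w u :: "'i \<Rightarrow> real" and z :: complex
  assumes "finite I" and "I \<noteq> {}" and w: "\<And>i. i \<in> I \<Longrightarrow> w i > 0"
    and root: "(\<Sum>i\<in>I. of_real (w i) / (z - of_real (u i))\<^sup>2) = 1"
  shows "\<exists>i\<in>I. cmod (z - of_real (u i)) \<le> sqrt (sum w I)"
proof (rule ccontr)
  assume "\<not> ?thesis"
  then have far: "sqrt (sum w I) < cmod (z - of_real (u i))" if "i \<in> I" for i
    using that by force
  have W: "sum w I > 0" using assms by (simp add: sum_pos)
  have "1 = cmod (\<Sum>i\<in>I. of_real (w i) / (z - of_real (u i))\<^sup>2)"
    using root by simp
  also have "\<dots> \<le> (\<Sum>i\<in>I. cmod (of_real (w i) / (z - of_real (u i))\<^sup>2))"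
    by (rule norm_sum)
  also have "\<dots> < (\<Sum>i\<in>I. w i / sum w I)"
  proof (rule sum_strict_mono)
    fix i assume i: "i \<in> I"
    have "sum w I < (cmod (z - of_real (u i)))\<^sup>2"
      using power_strict_mono[OF far[OF i], of 2] W by simp
    moreover from this W have "0 < (cmod (z - of_real (u i)))\<^sup>2 * sum w I"
      by (intro mult_pos_pos) linarith+
    ultimately have "w i / (cmod (z - of_real (u i)))\<^sup>2 < w i / sum w I"
      using w[OF i] by (intro divide_strict_left_mono)
    then show "cmod (of_real (w i) / (z - of_real (u i))\<^sup>2) < w i / sum w I"
      using w[OF i] by (simp add: norm_divide norm_power)
  qed (use assms in auto)
  also have "\<dots> = 1"
    using W by (simp flip: sum_divide_distrib)
  finally show False by simp
qed

text \<open>Existence comes from the intermediate value theorem on a compact interval away from the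
  pole \<open>u k\<close>, uniqueness from strict monotonicity on the whole half-line beyond
  it.\<close>

lemma secular_root_right:
  fixes w u :: "'i \<Rightarrow> real"
  assumes fin: "finite I" and k: "k \<in> I" and w: "\<And>i. i \<in> I \<Longrightarrow> w i > 0"
    and max: "\<And>i. i \<in> I \<Longrightarrow> u i \<le> u k"
  shows "\<exists>!x. x \<in> {u k <.. u k + sqrt (sum w I)} \<and> (\<Sum>i\<in>I. w i / (x - u i)\<^sup>2) = 1"
proof -
  define F where "F x = (\<Sum>i\<in>I. w i / (x - u i)\<^sup>2)" for x
  have W: "sum w I > 0" using assms by (auto intro: sum_pos)
  have wk: "w k \<le> sum w I"
    using assms by (intro member_le_sum) (auto intro: less_imp_le)
  \<comment> \<open>Since \<open>u k\<close> is the largest pole, every distance x - u_i is positive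
    and grows with x.\<close>
  have anti: "F y < F x" if "u k < x" "x < y" for x y
    unfolding F_def
  proof (rule sum_strict_mono)
    fix i assume i: "i \<in> I"
    have "(x - u i)\<^sup>2 < (y - u i)\<^sup>2" "(x - u i)\<^sup>2 > 0" "(y - u i)\<^sup>2 > 0"
      using that max[OF i] by (auto intro: power_strict_mono)
    then show "w i / (y - u i)\<^sup>2 < w i / (x - u i)\<^sup>2"
      using w[OF i] by (intro divide_strict_left_mono mult_pos_pos)
  qed (use fin k in auto)
  \<comment> \<open>At \<open>p\<close> the k-th summand alone equals 1, which replaces the limit at
    the pole. At \<open>q\<close> every x - u_i is at least sqrt (sum w I), so each summand is at
    most its share of the total weight. With a single pole, \<open>p\<close> and \<open>q\<close>
    coincide.\<close>
  define p q where "p = u k + sqrt (w k)" and "q = u k + sqrt (sum w I)"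
  have "u k < p" "p \<le> q" using wk w[OF k] by (auto simp: p_def q_def)
  have "1 = w k / (p - u k)\<^sup>2" using w[OF k] by (simp add: p_def)
  also have "\<dots> \<le> F p"
    unfolding F_def using fin k w
    by (intro member_le_sum[where f = "\<lambda>i. w i / (p - u i)\<^sup>2"])
       (auto intro!: divide_nonneg_nonneg intro: less_imp_le)
  finally have Fp: "1 \<le> F p" .
  have "F q \<le> (\<Sum>i\<in>I. w i / sum w I)"
    unfolding F_def
  proof (rule sum_mono)
    fix i assume i: "i \<in> I"
    have "sqrt (sum w I) \<le> q - u i" using max[OF i] by (simp add: q_def)
    then have "sum w I \<le> (q - u i)\<^sup>2"
      using W by (metis less_imp_le power_mono real_sqrt_ge_0_iff real_sqrt_pow2)
    moreover from this W have "0 < (q - u i)\<^sup>2 * sum w I"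
      by (intro mult_pos_pos) linarith+
    ultimately show "w i / (q - u i)\<^sup>2 \<le> w i / sum w I"
      using w[OF i] by (intro divide_left_mono) auto
  qed
  also have "\<dots> = 1" using W by (simp flip: sum_divide_distrib)
  finally have Fq: "F q \<le> 1" .
  \<comment> \<open>All poles are at most \<open>u k\<close> < \<open>p\<close>, so no denominator
    vanishes on the interval.\<close>
  have "continuous_on {p..q} F"
    unfolding F_def using \<open>u k < p\<close> max by (intro continuous_intros) force
  then obtain x where x: "p \<le> x" "x \<le> q" "F x = 1"
    using IVT2'[of F q 1 p] Fp Fq \<open>p \<le> q\<close> by blast
  show ?thesis
  proof (rule ex1I[of _ x])
    show "x \<in> {u k <.. u k + sqrt (sum w I)} \<and> (\<Sum>i\<in>I. w i / (x - u i)\<^sup>2) = 1"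
      using x \<open>u k < p\<close> by (simp add: F_def q_def)
  next
    fix y assume "y \<in> {u k <.. u k + sqrt (sum w I)} \<and> (\<Sum>i\<in>I. w i / (y - u i)\<^sup>2) = 1"
    then have "u k < y" "F y = F x" using x by (auto simp: F_def)
    then show "y = x"
      using anti[of x y] anti[of y x] x(1) \<open>u k < p\<close> by (cases x y rule: linorder_cases) auto
  qed
qed

text \<open>The reflection x \<mapsto> -x, applied to the poles as well, preserves the squares and
  turns the smallest pole into the largest, so \<open>secular_root_right\<close> applies.\<close>

lemma secular_root_left:
  fixes w u :: "'i \<Rightarrow> real"
  assumes "finite I" and "k \<in> I" and "\<And>i. i \<in> I \<Longrightarrow> w i > 0"
    and "\<And>i. i \<in> I \<Longrightarrow> u k \<le> u i"
  shows "\<exists>!x. x \<in> {u k - sqrt (sum w I) ..< u k} \<and> (\<Sum>i\<in>I. w i / (x - u i)\<^sup>2) = 1"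
proof -
  define P where "P x \<longleftrightarrow> x \<in> {u k - sqrt (sum w I) ..< u k} \<and> (\<Sum>i\<in>I. w i / (x - u i)\<^sup>2) = 1"
    for x
  have "(- x - u i)\<^sup>2 = (x - - u i)\<^sup>2" for x i
    by (simp add: power2_eq_square algebra_simps)
  then have "P (- x) \<longleftrightarrow> x \<in> {- u k <.. - u k + sqrt (sum w I)} \<and>
      (\<Sum>i\<in>I. w i / (x - - u i)\<^sup>2) = 1" for x
    by (auto simp: P_def)
  then have "\<exists>!x. P (- x)"
    using secular_root_right[of I k w "\<lambda>i. - u i"] assms by simp
  then have "\<exists>!x. P x" by (metis minus_minus)
  then show ?thesis by (simp add: P_def)
qed

section \<open>From the eigenvectors of the block matrix to the secular equation\<close>

lemma diag_of_vec_mult_vec: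
  fixes v x :: "'a :: semiring_0 vec"
  assumes "v \<in> carrier_vec n" and "x \<in> carrier_vec n" and "i < n"
  shows "(diag_of_vec v *\<^sub>v x) $ i = v $ i * x $ i"
proof -
  \<comment> \<open>The delta rules are held back here so that both sides remain sums that can be
    compared termwise; the last step collapses the sum.\<close>
  have "(diag_of_vec v *\<^sub>v x) $ i = (\<Sum>j<n. if j = i then v $ i * x $ i else 0)"
    using assms
    by (auto simp: diag_of_vec_def mat_diag_def scalar_prod_def lessThan_atLeast0
        simp del: sum.delta sum.delta' intro!: sum.cong)
  then show ?thesis using assms by simp
qed

text \<open>Serves to split an eigenvector along the two blocks.\<close>

lemma bex_append_vec:
  "(\<exists>v\<in>carrier_vec (n + m). P v) \<longleftrightarrow> (\<exists>a\<in>carrier_vec n. \<exists>b\<in>carrier_vec m. P (a @\<^sub>v b))"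
proof
  assume "\<exists>v\<in>carrier_vec (n + m). P v"
  then obtain v where "v \<in> carrier_vec (n + m)" "P v" ..
  then have "P (vec_first v n @\<^sub>v vec_last v m)" by simp
  then show "\<exists>a\<in>carrier_vec n. \<exists>b\<in>carrier_vec m. P (a @\<^sub>v b)"
    using vec_first_carrier vec_last_carrier by blast
qed (auto intro: append_carrier_vec)

lemma map_mat_diag_of_vec:
  "map_mat complex_of_real (diag_of_vec v) = diag_of_vec (map_vec complex_of_real v)"
  by (auto simp: diag_of_vec_def mat_diag_def)

context
  fixes N :: nat and g :: real and \<gamma> H U :: "real vec"
  assumes \<gamma>: "\<gamma> \<in> carrier_vec N" and H: "H \<in> carrier_vec N" and U: "U \<in> carrier_vec N"
begin

text \<open>All rows of the lower left block are equal, so the components are coupled only through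
  the one scalar g * (SUM j. gamma_j a_j). This rank-one structure makes the later elimination
  possible.\<close>

lemma A_mat_eigen_eq_iff:
  assumes a: "a \<in> carrier_vec N" and b: "b \<in> carrier_vec N"
  shows "map_mat complex_of_real (A_mat N g \<gamma> H U) *\<^sub>v (a @\<^sub>v b) = z \<cdot>\<^sub>v (a @\<^sub>v b) \<longleftrightarrow>
    (\<forall>i<N. of_real (U $ i) * a $ i + of_real (H $ i) * b $ i = z * a $ i) \<and>
    (\<forall>i<N. of_real g * (\<Sum>j<N. of_real (\<gamma> $ j) * a $ j) + of_real (U $ i) * b $ i = z * b $ i)"
proof -
  let ?c = complex_of_real
  let ?D = "diag_of_vec (map_vec ?c U)" and ?E = "diag_of_vec (map_vec ?c H)"
  let ?G = "map_mat ?c (g \<cdot>\<^sub>m outer_prod (ones_vec N) \<gamma>)"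
  have D: "?D \<in> carrier_mat N N" and E: "?E \<in> carrier_mat N N" and G: "?G \<in> carrier_mat N N"
    using \<gamma> H U by (auto simp: diag_of_vec_def outer_prod_def ones_vec_def)
  have "map_mat ?c (A_mat N g \<gamma> H U) = four_block_mat ?D ?E ?G ?D"
    unfolding A_mat_def map_mat_diag_of_vec[symmetric]
    by (rule map_four_block_mat[of _ N N _ N _ N])
       (use \<gamma> H U in \<open>auto simp: diag_of_vec_def outer_prod_def ones_vec_def\<close>)
  then have "map_mat ?c (A_mat N g \<gamma> H U) *\<^sub>v (a @\<^sub>v b) =
      (?D *\<^sub>v a + ?E *\<^sub>v b) @\<^sub>v (?G *\<^sub>v a + ?D *\<^sub>v b)"
    using four_block_mat_mult_vec[OF D E G D a b] by simp
  moreover have "z \<cdot>\<^sub>v (a @\<^sub>v b) = (z \<cdot>\<^sub>v a) @\<^sub>v (z \<cdot>\<^sub>v b)"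
    by (rule eq_vecI) (use a b in auto)
  moreover have "(?D *\<^sub>v a + ?E *\<^sub>v b) @\<^sub>v (?G *\<^sub>v a + ?D *\<^sub>v b) = (z \<cdot>\<^sub>v a) @\<^sub>v (z \<cdot>\<^sub>v b) \<longleftrightarrow>
      ?D *\<^sub>v a + ?E *\<^sub>v b = z \<cdot>\<^sub>v a \<and> ?G *\<^sub>v a + ?D *\<^sub>v b = z \<cdot>\<^sub>v b"
    by (rule append_vec_eq[where n = N]) (use D E a b in \<open>auto intro!: add_carrier_vec\<close>)
  moreover have "?D *\<^sub>v a + ?E *\<^sub>v b = z \<cdot>\<^sub>v a \<longleftrightarrow>
      (\<forall>i<N. ?c (U $ i) * a $ i + ?c (H $ i) * b $ i = z * a $ i)"
    using D E a b U H
      diag_of_vec_mult_vec[of "map_vec ?c U" N a] diag_of_vec_mult_vec[of "map_vec ?c H" N b]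
    by (auto simp: vec_eq_iff simp del: index_mult_mat_vec)
  moreover have "(?G *\<^sub>v a) $ i = ?c g * (\<Sum>j<N. ?c (\<gamma> $ j) * a $ j)" if "i < N" for i
    using that \<gamma> a
    by (auto simp: outer_prod_def ones_vec_def scalar_prod_def sum_distrib_left lessThan_atLeast0
        mult.assoc intro!: sum.cong)
  then have "?G *\<^sub>v a + ?D *\<^sub>v b = z \<cdot>\<^sub>v b \<longleftrightarrow>
      (\<forall>i<N. ?c g * (\<Sum>j<N. ?c (\<gamma> $ j) * a $ j) + ?c (U $ i) * b $ i = z * b $ i)"
    using D G a b U diag_of_vec_mult_vec[of "map_vec ?c U" N b]
    by (auto simp: vec_eq_iff simp del: index_mult_mat_vec)
  ultimately show ?thesis by simp
qed

lemma complex_spectrum_A_mat_iff: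
  "z \<in> complex_spectrum (A_mat N g \<gamma> H U) \<longleftrightarrow>
    (\<exists>a\<in>carrier_vec N. \<exists>b\<in>carrier_vec N. a @\<^sub>v b \<noteq> 0\<^sub>v (N + N) \<and>
      (\<forall>i<N. of_real (U $ i) * a $ i + of_real (H $ i) * b $ i = z * a $ i) \<and>
      (\<forall>i<N. of_real g * (\<Sum>j<N. of_real (\<gamma> $ j) * a $ j) + of_real (U $ i) * b $ i = z * b $ i))"
proof -
  let ?B = "map_mat complex_of_real (A_mat N g \<gamma> H U)"
  have dim: "dim_row ?B = N + N"
    using U by (simp add: A_mat_def diag_of_vec_def mat_diag_def)
  have "z \<in> complex_spectrum (A_mat N g \<gamma> H U) \<longleftrightarrow>
      (\<exists>v\<in>carrier_vec (N + N). v \<noteq> 0\<^sub>v (N + N) \<and> ?B *\<^sub>v v = z \<cdot>\<^sub>v v)"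
    unfolding complex_spectrum_def spectrum_def eigenvalue_def eigenvector_def dim by auto
  also have "\<dots> \<longleftrightarrow> (\<exists>a\<in>carrier_vec N. \<exists>b\<in>carrier_vec N. a @\<^sub>v b \<noteq> 0\<^sub>v (N + N) \<and>
      ?B *\<^sub>v (a @\<^sub>v b) = z \<cdot>\<^sub>v (a @\<^sub>v b))"
    by (rule bex_append_vec)
  finally show ?thesis by (simp add: A_mat_eigen_eq_iff cong: bex_cong)
qed

text \<open>Put s = SUM j. gamma_j a_j. The lower rows give b as a multiple of s, the upper rows
  then give a, and inserting a into s closes the system as s = F s. The points u_i are excluded
  because of the divisions by z - u_i: there the convention x / 0 = 0 would drop summands of the
  secular equation.\<close>

lemma spectrum_iff_secular:
  assumes N: "N \<ge> 1" and z: "\<And>i. i < N \<Longrightarrow> z \<noteq> of_real (U $ i)"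
  shows "z \<in> complex_spectrum (A_mat N g \<gamma> H U) \<longleftrightarrow>
    (\<Sum>i<N. of_real (g * (\<gamma> $ i * H $ i)) / (z - of_real (U $ i))\<^sup>2) = 1"
proof -
  let ?c = complex_of_real
  define F where "F = (\<Sum>i<N. ?c (g * (\<gamma> $ i * H $ i)) / (z - ?c (U $ i))\<^sup>2)"
  have nz: "z - ?c (U $ i) \<noteq> 0" if "i < N" for i using z[OF that] by simp
  show ?thesis
    unfolding F_def[symmetric]
  proof
    assume "z \<in> complex_spectrum (A_mat N g \<gamma> H U)"
    then obtain a b where ab: "a \<in> carrier_vec N" "b \<in> carrier_vec N" "a @\<^sub>v b \<noteq> 0\<^sub>v (N + N)"
      and top: "\<And>i. i < N \<Longrightarrow> ?c (U $ i) * a $ i + ?c (H $ i) * b $ i = z * a $ i"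
      and bot: "\<And>i. i < N \<Longrightarrow>
        ?c g * (\<Sum>j<N. ?c (\<gamma> $ j) * a $ j) + ?c (U $ i) * b $ i = z * b $ i"
      unfolding complex_spectrum_A_mat_iff by blast
    define s where "s = (\<Sum>j<N. ?c (\<gamma> $ j) * a $ j)"
    have b: "b $ i = ?c g * s / (z - ?c (U $ i))" if "i < N" for i
      using bot[OF that] nz[OF that] unfolding s_def[symmetric]
      by (simp add: field_simps)
    have a: "a $ i = ?c (H $ i) * b $ i / (z - ?c (U $ i))" if "i < N" for i
      using top[OF that] nz[OF that] by (simp add: field_simps)
    \<comment> \<open>Both a and b are multiples of s, so s = 0 would make the eigenvector
      vanish.\<close>
    have "s \<noteq> 0"
    proof
      assume "s = 0"
      then have "a $ i = 0 \<and> b $ i = 0" if "i < N" for i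
        using a b that by simp
      then have "a @\<^sub>v b = 0\<^sub>v (N + N)"
        using ab by (intro eq_vecI) auto
      then show False using ab by simp
    qed
    have "s = (\<Sum>i<N. ?c (g * (\<gamma> $ i * H $ i)) / (z - ?c (U $ i))\<^sup>2 * s)"
      by (subst s_def, intro sum.cong) (auto simp: a b power2_eq_square)
    then have "s = F * s" by (simp add: F_def sum_distrib_right)
    then show "F = 1" using \<open>s \<noteq> 0\<close> by simp
  next
    assume F: "F = 1"
    \<comment> \<open>These are the formulas of the forward direction normalized by s = 1. The
      hypothesis F = 1 says exactly that this normalization is consistent, and s = 1 also shows that
      the vector is nonzero.\<close>
    define b where "b = vec N (\<lambda>i. ?c g / (z - ?c (U $ i)))"
    define a where "a = vec N (\<lambda>i. ?c (H $ i) * ?c g / (z - ?c (U $ i))\<^sup>2)"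
    have carr: "a \<in> carrier_vec N" "b \<in> carrier_vec N" by (auto simp: a_def b_def)
    have s: "(\<Sum>j<N. ?c (\<gamma> $ j) * a $ j) = 1"
      unfolding F[symmetric] F_def a_def by (intro sum.cong) (auto simp: algebra_simps)
    have "a @\<^sub>v b \<noteq> 0\<^sub>v (N + N)"
    proof
      assume *: "a @\<^sub>v b = 0\<^sub>v (N + N)"
      have "a $ i = 0" if "i < N" for i
        using arg_cong[OF *, of "\<lambda>v. v $ i"] that carr by auto
      then show False using s by simp
    qed
    moreover have "?c (U $ i) * a $ i + ?c (H $ i) * b $ i = z * a $ i" if "i < N" for i
    proof -
      have "?c (H $ i) * b $ i = (z - ?c (U $ i)) * a $ i"
        using nz[OF that] that by (simp add: a_def b_def power2_eq_square)
      then show ?thesis by (simp add: left_diff_distrib)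
    qed
    moreover have "?c g * (\<Sum>j<N. ?c (\<gamma> $ j) * a $ j) + ?c (U $ i) * b $ i = z * b $ i"
      if "i < N" for i
      unfolding s using nz[OF that] that by (simp add: b_def field_simps)
    ultimately show "z \<in> complex_spectrum (A_mat N g \<gamma> H U)"
      unfolding complex_spectrum_A_mat_iff using carr by blast
  qed
qed

end

section \<open>Localization of the spectrum and the two extreme eigenvalues\<close>

theorem proposition5p7:
  fixes N :: nat and g :: real and \<gamma> H U :: "real vec"
  assumes "N \<ge> 1" and "g > 0"
    and "\<gamma> \<in> carrier_vec N" and "H \<in> carrier_vec N" and "U \<in> carrier_vec N"
    and "\<And>i. i < N \<Longrightarrow> \<gamma> $ i > 0" and "(\<Sum>i<N. \<gamma> $ i) = 1"
    and "\<And>i. i < N \<Longrightarrow> H $ i > 0"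
  defines "A \<equiv> A_mat N g \<gamma> H U" and "h \<equiv> mean_height N \<gamma> H"
  shows "complex_spectrum A \<subseteq> J_minus g h U \<union> J_plus g h U \<union> (\<Union>i<N. D_set g h U i) \<and>
         (\<exists>c\<^sub>m c\<^sub>p. complex_spectrum A \<inter> J_minus g h U = {c\<^sub>m} \<and>
                  complex_spectrum A \<inter> J_plus g h U = {c\<^sub>p})"
proof -
  \<comment> \<open>The total weight is g h, so the radius in the secular lemmas becomes
    \<open>R\<close>.\<close>
  define w where "w i = g * (\<gamma> $ i * H $ i)" for i
  define R where "R = sqrt (g * h)"
  have I: "finite {..<N}" "{..<N} \<noteq> {}" using assms(1) by (auto simp: lessThan_empty_iff)
  have w: "w i > 0" if "i \<in> {..<N}" for i
    using assms that by (simp add: w_def)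
  have gh: "sum w {..<N} = g * h"
    by (simp add: w_def h_def mean_height_def sum_distrib_left)
  then have R: "R > 0" using sum_pos[OF I, of w] w by (simp add: R_def)
  have dim: "dim_vec U = N" using assms(5) by simp
  \<comment> \<open>The index set is finite and nonempty, so infimum and supremum are attained. Thus
    both are poles, at \<open>k\<close> and \<open>l\<close>, from which the root intervals
    start.\<close>
  have um: "u_minus U = Min ((\<lambda>i. U $ i) ` {..<N})"
    unfolding u_minus_def dim using I by (intro cInf_eq_Min) auto
  have up: "u_plus U = Max ((\<lambda>i. U $ i) ` {..<N})"
    unfolding u_plus_def dim using I by (intro cSup_eq_Max) auto
  have "u_minus U \<in> (\<lambda>i. U $ i) ` {..<N}"
    unfolding um using I by (intro Min_in) auto
  then obtain k where k: "k < N" "u_minus U = U $ k" by blast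
  have "u_plus U \<in> (\<lambda>i. U $ i) ` {..<N}"
    unfolding up using I by (intro Max_in) auto
  then obtain l where l: "l < N" "u_plus U = U $ l" by blast
  have ge: "u_minus U \<le> U $ i" and le: "U $ i \<le> u_plus U" if "i < N" for i
    using that by (auto simp: um up)
  have spec: "z \<in> complex_spectrum A \<longleftrightarrow> (\<Sum>i<N. of_real (w i) / (z - of_real (U $ i))\<^sup>2) = 1"
    if "\<And>i. i < N \<Longrightarrow> z \<noteq> of_real (U $ i)" for z
    using spectrum_iff_secular[OF assms(3-5,1) that] by (simp add: A_def w_def)
  \<comment> \<open>At real points the complex equation is the image of the real one, which makes
    the monotonicity results available.\<close>
  have spec_real: "of_real x \<in> complex_spectrum A \<longleftrightarrow> (\<Sum>i<N. w i / (x - U $ i)\<^sup>2) = 1"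
    if "\<And>i. i < N \<Longrightarrow> x \<noteq> U $ i" for x
  proof -
    have "of_real x \<in> complex_spectrum A \<longleftrightarrow>
        (\<Sum>i<N. of_real (w i) / (of_real x - of_real (U $ i))\<^sup>2) = complex_of_real 1"
      using spec[of "of_real x"] that by simp
    also have "(\<Sum>i<N. of_real (w i) / (of_real x - of_real (U $ i))\<^sup>2) =
        complex_of_real (\<Sum>i<N. w i / (x - U $ i)\<^sup>2)"
      by simp
    finally show ?thesis by (simp only: of_real_eq_iff)
  qed
  have "z \<in> J_minus g h U \<union> J_plus g h U \<union> (\<Union>i<N. D_set g h U i)"
    if z: "z \<in> complex_spectrum A" for z
  proof (cases "\<exists>i<N. z = of_real (U $ i)")
    \<comment> \<open>Any eigenvalue equal to some u_i is outside the reach of the secular equation,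
      but it is the centre of its own disc.\<close>
    case True
    then obtain i where i: "i < N" "z = of_real (U $ i)" by auto
    then have "z \<in> D_set g h U i"
      using R ge le by (simp add: D_set_def R_def)
    then show ?thesis using i by blast
  next
    case False
    then have root: "(\<Sum>i<N. of_real (w i) / (z - of_real (U $ i))\<^sup>2) = 1"
      using spec z by blast
    obtain i where i: "i < N" "cmod (z - of_real (U $ i)) \<le> R"
      using secular_root_close[OF I w root] by (auto simp: gh R_def)
    \<comment> \<open>As u_- \<le> u_i \<le> u_+, this bound puts Re z within \<open>R\<close> of
      [u_-, u_+]. When Re z lies outside that interval, z is real and falls into one of the J
      sets.\<close>
    have Re: "\<bar>Re z - U $ i\<bar> \<le> R"
      using abs_Re_le_cmod[of "z - of_real (U $ i)"] i(2) by simp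
    consider "u_minus U \<le> Re z \<and> Re z \<le> u_plus U" | "Re z < u_minus U" | "u_plus U < Re z"
      by linarith
    then show ?thesis
    proof cases
      case 1
      then have "z \<in> D_set g h U i" using i by (simp add: D_set_def R_def)
      then show ?thesis using i by blast
    next
      case 2
      then have "\<forall>j\<in>{..<N}. Re z < U $ j" using ge by force
      then have "Im z = 0" using secular_root_real[OF I w _ root] by blast
      then have "z = of_real (Re z)" by (simp add: complex_eq_iff)
      moreover have "Re z \<in> {u_minus U - R ..< u_minus U}"
        using 2 Re ge[OF i(1)] by auto
      ultimately show ?thesis unfolding J_minus_def R_def by blast
    next
      case 3
      then have "\<forall>j\<in>{..<N}. U $ j < Re z" using le by force
      then have "Im z = 0" using secular_root_real[OF I w _ root] by blast
      then have "z = of_real (Re z)" by (simp add: complex_eq_iff)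
      moreover have "Re z \<in> {u_plus U <.. u_plus U + R}"
        using 3 Re le[OF i(1)] by auto
      ultimately show ?thesis unfolding J_plus_def R_def by blast
    qed
  qed
  moreover have "\<exists>c. complex_spectrum A \<inter> J_minus g h U = {c}"
  proof -
    \<comment> \<open>The interval contains no u_i, so spectrum membership there is the real secular
      equation. As \<open>J_minus\<close> consists of real points only, the unique real root is the
      unique eigenvalue in it.\<close>
    have iff: "of_real x \<in> complex_spectrum A \<longleftrightarrow> (\<Sum>i<N. w i / (x - U $ i)\<^sup>2) = 1"
      if "x \<in> {u_minus U - R ..< u_minus U}" for x
      by (rule spec_real) (use that ge in force)
    have "\<exists>!x. x \<in> {u_minus U - R ..< u_minus U} \<and> (\<Sum>i<N. w i / (x - U $ i)\<^sup>2) = 1"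
      using secular_root_left[of "{..<N}" k w "\<lambda>i. U $ i"] w k ge by (simp add: gh R_def)
    then obtain x where "x \<in> {u_minus U - R ..< u_minus U}" "of_real x \<in> complex_spectrum A"
      "\<And>y. y \<in> {u_minus U - R ..< u_minus U} \<Longrightarrow> of_real y \<in> complex_spectrum A \<Longrightarrow> y = x"
      using iff by metis
    then have "complex_spectrum A \<inter> J_minus g h U = {of_real x}"
      unfolding J_minus_def R_def[symmetric] by blast
    then show ?thesis ..
  qed
  moreover have "\<exists>c. complex_spectrum A \<inter> J_plus g h U = {c}"
  proof -
    have iff: "of_real x \<in> complex_spectrum A \<longleftrightarrow> (\<Sum>i<N. w i / (x - U $ i)\<^sup>2) = 1"
      if "x \<in> {u_plus U <.. u_plus U + R}" for x
      by (rule spec_real) (use that le in force)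
    \<comment> \<open>The largest entry, at \<open>l\<close>, now plays the part that the smallest
      one had on the left.\<close>
    have "\<exists>!x. x \<in> {u_plus U <.. u_plus U + R} \<and> (\<Sum>i<N. w i / (x - U $ i)\<^sup>2) = 1"
      using secular_root_right[of "{..<N}" l w "\<lambda>i. U $ i"] w l le by (simp add: gh R_def)
    then obtain x where "x \<in> {u_plus U <.. u_plus U + R}" "of_real x \<in> complex_spectrum A"
      "\<And>y. y \<in> {u_plus U <.. u_plus U + R} \<Longrightarrow> of_real y \<in> complex_spectrum A \<Longrightarrow> y = x"
      using iff by metis
    then have "complex_spectrum A \<inter> J_plus g h U = {of_real x}"
      unfolding J_plus_def R_def[symmetric] by blast
    then show ?thesis ..
  qed
  ultimately show ?thesis by blast
qed

end
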